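(* Let $(r,s)\in\mathbb{R}^2$ and $(a,b)\in\mathbb{R}_+^2$ with $a\neq b$ be fixed, and consider the more extended means $F(p,q;r,s;a,b)$ as a function of $(p,q)$. (i) If $r+s>0$, then $(p,q)\mapsto F(p,q;r,s;a,b)$ is strictly bivariate log-concave on $[0,\infty)\times[0,\infty)$ and strictly bivariate log-convex on $(-\infty,0]\times(-\infty,0]$. (ii) If $r+s<0$, then $(p,q)\mapsto F(p,q;r,s;a,b)$ is strictly bivariate log-convex on $[0,\infty)\times[0,\infty)$ and strictly bivariate log-concave on $(-\infty,0]\times(-\infty,0]$.
   Context: Notation: $\mathbb{R}_+=(0,\infty)$. More extended (four-parameter) means: for $a,b\in\mathbb{R}_+$ with $a\ne b$, $$F(p,q;r,s;a,b)=\left(\frac{a^{pr}-b^{pr}}{a^{ps}-b^{ps}}\cdot\frac{a^{qs}-b^{qs}}{a^{qr}-b^{qr}}\right)^{\frac{1}{(p-q)(r-s)}}\quad\text{if } pqrs(p-q)(r-s)\neq 0,$$ and $F(p,q;r,s;a,b)$ is defined as the corresponding limit if $pqrs(p-q)(r-s)=0$; also $F(p,q;r,s;a,a)=a$. For example, with $L(x,y)=\frac{x-y}{\ln x-\ln y}$ the logarithmic mean and $I(x,y)=e^{-1}\left(x^x/y^y\right)^{1/(x-y)}$ the identric mean ($x\neq y$; $L(x,x)=I(x,x)=x$), one has, when $rs(r-s)\ne0$ and $p\ne 0$: $F(p,p;r,s;a,b)=\left(\frac{I(a^{pr},b^{pr})}{I(a^{ps},b^{ps})}\right)^{\frac1{p(r-s)}}$,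 $F(p,0;r,s;a,b)=\left(\frac{L(a^{pr},b^{pr})}{L(a^{ps},b^{ps})}\right)^{\frac1{p(r-s)}}$, and $F(0,0;r,s;a,b)=\sqrt{ab}$. Equivalently, these means are generated by the Stolarsky means $S_{r,s}$: $F(p,q;r,s;a,b)=\left(\frac{S_{r,s}(a^p,b^p)}{S_{r,s}(a^q,b^q)}\right)^{1/(p-q)}$ for $p\neq q$, and $F(p,p;r,s;a,b)$ is the limit as $q\to p$. Here $S_{r,s}(x,x)=x$ and for $x\ne y$: $S_{r,s}(x,y)=\left(\frac{s(x^r-y^r)}{r(x^s-y^s)}\right)^{1/(r-s)}$ if $rs(r-s)\neq0$; $S_{r,0}(x,y)=S_{0,r}(x,y)=\left(\frac{x^r-y^r}{r(\ln x-\ln y)}\right)^{1/r}$ if $r\neq 0$; $S_{r,r}(x,y)=\exp\left(\frac{x^r\ln x-y^r\ln y}{x^r-y^r}-\frac1r\right)$ if $r\ne0$; $S_{0,0}(x,y)=\sqrt{xy}$. A positive function $\Psi$ on a convex set $\Omega\subseteq\mathbb{R}^2$ is strictly bivariate log-convex (log-concave) if $\ln\Psi$ is strictly convex (strictly concave) as a function of two variables on $\Omega$. *)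

theory Defs
  imports "HOL-Analysis.Analysis"
begin

definition ext_nondeg :: "(real \<times> real \<times> real \<times> real) set" where
  "ext_nondeg = {(p, q, r, s). p * q * r * s * (p - q) * (r - s) \<noteq> 0}"

text \<open>For \<open>a \<noteq> b\<close> positive and non-degenerate parameters the base of the outer power is
  positive, so the real \<open>powr\<close> is the genuine power there.\<close>

definition ext_mean_formula :: "real \<Rightarrow> real \<Rightarrow> real \<Rightarrow> real \<Rightarrow> real \<Rightarrow> real \<Rightarrow> real" where
  "ext_mean_formula p q r s a b =
    ((a powr (p * r) - b powr (p * r)) / (a powr (p * s) - b powr (p * s)) *
     ((a powr (q * s) - b powr (q * s)) / (a powr (q * r) - b powr (q * r))))
      powr (1 / ((p - q) * (r - s)))"

text \<open>At degenerate parameters the mean is the limit of the formula as all four parameters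
  vary jointly through the non-degenerate ones (fixing \<open>r\<close> and \<open>s\<close> would leave nothing to
  approach along when \<open>r = s\<close> or \<open>r * s = 0\<close>). For positive \<open>a \<noteq> b\<close> this limit exists:
  with the continuous extension \<open>g\<close> of \<open>x \<mapsto> ln \<bar>(a powr x - b powr x) / x\<bar>\<close> to \<open>x = 0\<close>, which is
  smooth, the logarithm of the formula is the divided difference of \<open>(t, u) \<mapsto> g (t * u)\<close> over
  \<open>p, q\<close> in \<open>t\<close> and \<open>r, s\<close> in \<open>u\<close>. Hence it agrees with every iterated limit, in particular
  with the description through Stolarsky means.\<close>

definition ext_mean :: "real \<Rightarrow> real \<Rightarrow> real \<Rightarrow> real \<Rightarrow> real \<Rightarrow> real \<Rightarrow> real" where
  "ext_mean p q r s a b =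
    (if a = b then a
     else if (p, q, r, s) \<in> ext_nondeg then ext_mean_formula p q r s a b
     else Lim (at (p, q, r, s) within ext_nondeg)
            (\<lambda>(p', q', r', s'). ext_mean_formula p' q' r' s' a b))"

definition strictly_convex_on :: "'a::real_vector set \<Rightarrow> ('a \<Rightarrow> real) \<Rightarrow> bool" where
  "strictly_convex_on S f \<longleftrightarrow> convex S \<and>
    (\<forall>x\<in>S. \<forall>y\<in>S. \<forall>u>0. \<forall>v>0. x \<noteq> y \<longrightarrow> u + v = 1 \<longrightarrow>
      f (u *\<^sub>R x + v *\<^sub>R y) < u * f x + v * f y)"

definition strictly_concave_on :: "'a::real_vector set \<Rightarrow> ('a \<Rightarrow> real) \<Rightarrow> bool" where
  "strictly_concave_on S f \<longleftrightarrow> strictly_convex_on S (\<lambda>x. - f x)"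

definition strictly_bivariate_log_convex_on :: "(real \<times> real) set \<Rightarrow> (real \<times> real \<Rightarrow> real) \<Rightarrow> bool" where
  "strictly_bivariate_log_convex_on \<Omega> \<Psi> \<longleftrightarrow>
    (\<forall>z\<in>\<Omega>. \<Psi> z > 0) \<and> strictly_convex_on \<Omega> (\<lambda>z. ln (\<Psi> z))"

definition strictly_bivariate_log_concave_on :: "(real \<times> real) set \<Rightarrow> (real \<times> real \<Rightarrow> real) \<Rightarrow> bool" where
  "strictly_bivariate_log_concave_on \<Omega> \<Psi> \<longleftrightarrow>
    (\<forall>z\<in>\<Omega>. \<Psi> z > 0) \<and> strictly_concave_on \<Omega> (\<lambda>z. ln (\<Psi> z))"

end

theory Submission
  imports Defs "HOL-Real_Asymp.Real_Asymp"
begin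

text \<open>
  Write \<open>c = \<bar>ln a - ln b\<bar> / 2\<close> and \<open>\<phi>(x) = (x coth x)'\<close>. Since \<open>a powr x - b powr x\<close> is
  \<open>(a * b) powr (x / 2)\<close> times \<open>2 sinh\<close> of a multiple of \<open>x\<close>, and since \<open>\<phi>(t * u)\<close> is the mixed
  derivative of \<open>ln (sinh (t * u) / (t * u))\<close> in \<open>t\<close> and \<open>u\<close>, the logarithm of the mean is
  \<open>ln (a * b) / 2\<close> plus \<open>c\<close> times the average of \<open>\<phi>(t * u)\<close> over \<open>t\<close> in the segment \<open>[q, p]\<close> and
  \<open>u\<close> in the segment \<open>[c * s, c * r]\<close>. This average is continuous in all four parameters, so it
  also gives the degenerate means. As \<open>\<phi>\<close> is odd and strictly concave on \<open>[0, \<infinity>)\<close>, and for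
  \<open>r + s > 0\<close> the negative part of the \<open>u\<close>-segment cancels against its mirror image, the inner
  average is strictly concave in \<open>t \<ge> 0\<close>, hence the double average is strictly concave in
  \<open>(p, q)\<close>. The other cases follow by oddness in \<open>(p, q)\<close> and in \<open>(r, s)\<close>.
\<close>

section \<open>Strict convexity and averages over segments\<close>

lemma strictly_concave_on_iff:
  "strictly_concave_on S f \<longleftrightarrow> convex S \<and>
    (\<forall>x\<in>S. \<forall>y\<in>S. \<forall>u>0. \<forall>v>0. x \<noteq> y \<longrightarrow> u + v = 1 \<longrightarrow>
      u * f x + v * f y < f (u *\<^sub>R x + v *\<^sub>R y))"
  unfolding strictly_concave_on_def strictly_convex_on_def by (simp add: algebra_simps)

lemma strictly_concave_onD:
  assumes "strictly_concave_on S f" "x \<in> S" "y \<in> S" "u > 0" "v > 0" "u + v = 1"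
  shows "u * f x + v * f y \<le> f (u *\<^sub>R x + v *\<^sub>R y)"
    and "x \<noteq> y \<Longrightarrow> u * f x + v * f y < f (u *\<^sub>R x + v *\<^sub>R y)"
proof -
  show *: "x \<noteq> y \<Longrightarrow> u * f x + v * f y < f (u *\<^sub>R x + v *\<^sub>R y)"
    using assms by (auto simp: strictly_concave_on_iff)
  have "u * f x + v * f x = f (u *\<^sub>R x + v *\<^sub>R x)"
    using assms(6) by (simp flip: distrib_right scaleR_add_left)
  with * show "u * f x + v * f y \<le> f (u *\<^sub>R x + v *\<^sub>R y)"
    by (cases "x = y") auto
qed

lemma strictly_concave_on_affine:
  assumes "strictly_concave_on S f" "c > 0"
  shows "strictly_concave_on S (\<lambda>x. m + c * f x)"
  unfolding strictly_concave_on_iff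
proof (intro conjI ballI allI impI)
  show "convex S" using assms(1) by (simp add: strictly_concave_on_iff)
  fix x y :: 'a and u v :: real
  assume *: "x \<in> S" "y \<in> S" "0 < u" "0 < v" "x \<noteq> y" "u + v = 1"
  have "u * f x + v * f y < f (u *\<^sub>R x + v *\<^sub>R y)"
    using strictly_concave_onD(2)[OF assms(1)] * by blast
  hence "c * (u * f x + v * f y) < c * f (u *\<^sub>R x + v *\<^sub>R y)"
    using assms(2) by simp
  moreover have "u * (m + c * f x) + v * (m + c * f y) = (u + v) * m + c * (u * f x + v * f y)"
    by (simp add: algebra_simps)
  ultimately show "u * (m + c * f x) + v * (m + c * f y) < m + c * f (u *\<^sub>R x + v *\<^sub>R y)"
    using * by simp
qed

lemma strictly_convex_on_const_minus:
  assumes "strictly_concave_on S f"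
  shows "strictly_convex_on S (\<lambda>x. k - f x)"
  using strictly_concave_on_affine[OF assms, of 1 "- k"] by (simp add: strictly_concave_on_def)

lemma strictly_concave_on_reflect:
  assumes "strictly_concave_on S f" "convex T" "\<And>x. x \<in> T \<Longrightarrow> - x \<in> S"
  shows "strictly_concave_on T (\<lambda>x. f (- x))"
  unfolding strictly_concave_on_iff
proof (intro conjI ballI allI impI)
  fix x y :: 'a and u v :: real
  assume *: "x \<in> T" "y \<in> T" "0 < u" "0 < v" "x \<noteq> y" "u + v = 1"
  thus "u * f (- x) + v * f (- y) < f (- (u *\<^sub>R x + v *\<^sub>R y))"
    using strictly_concave_onD(2)[OF assms(1), of "- x" "- y" u v] assms(3) by simp
qed (rule assms(2))

text \<open>The mean value theorem on both sides of an intermediate point \<open>z\<close> compares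
  the two chord slopes. Derivatives are asked for only at positive points, with the endpoint
  \<open>0\<close> reached by continuity, because the derivative formulas for \<open>dxcoth\<close>
  are proved away from \<open>0\<close>.\<close>

lemma strictly_concave_on_atLeast_deriv:
  fixes f f' :: "real \<Rightarrow> real"
  assumes cont: "continuous_on UNIV f"
    and deriv: "\<And>x. x > 0 \<Longrightarrow> (f has_real_derivative f' x) (at x)"
    and decr: "\<And>x y. 0 < x \<Longrightarrow> x < y \<Longrightarrow> f' y < f' x"
  shows "strictly_concave_on {0..} f"
proof -
  have key: "u * f x + v * f y < f (u * x + v * y)"
    if "0 \<le> x" "x < y" "0 < u" "0 < v" "u + v = 1" for x y u v :: real
  proof -
    define z where "z = u * x + v * y"
    have u: "u = 1 - v" using that by simp
    have zx: "z - x = v * (y - x)" and yz: "y - z = u * (y - x)"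
      unfolding z_def u by (simp_all add: algebra_simps)
    have lt: "x < z" "z < y"
      using zx yz that by (smt (verit) mult_pos_pos)+
    have MVT': "\<exists>l m. x' < m \<and> m < y' \<and> (f has_real_derivative l) (at m) \<and>
        f y' - f x' = (y' - x') * l" if "0 \<le> x'" "x' < y'" for x' y'
    proof (rule MVT[OF that(2)])
      show "continuous_on {x'..y'} f" using cont continuous_on_subset by blast
      show "f differentiable (at m)" if "x' < m" for m
        using deriv[of m] that \<open>0 \<le> x'\<close> real_differentiable_def by force
    qed
    obtain l1 m1 where 1: "x < m1" "m1 < z" "(f has_real_derivative l1) (at m1)"
        "f z - f x = (z - x) * l1"
      using MVT'[OF \<open>0 \<le> x\<close> lt(1)] by blast
    obtain l2 m2 where 2: "z < m2" "m2 < y" "(f has_real_derivative l2) (at m2)"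
        "f y - f z = (y - z) * l2"
      using MVT'[OF less_imp_le[OF le_less_trans[OF \<open>0 \<le> x\<close> lt(1)]] lt(2)] by blast
    have "l1 = f' m1" "l2 = f' m2"
      using DERIV_unique deriv 1 2 that lt by (meson le_less_trans less_trans)+
    hence "l2 < l1" using decr[of m1 m2] 1 2 that by simp
    \<comment> \<open>Since \<open>z - x = v * (y - x)\<close> and
      \<open>y - z = u * (y - x)\<close>, this factor makes both sides weighted increments of
      \<open>f\<close>.\<close>
    hence "(u * v * (y - x)) * l2 < (u * v * (y - x)) * l1"
      using that by simp
    hence "v * (f y - f z) < u * (f z - f x)"
      unfolding 1(4) 2(4) zx yz by (simp add: algebra_simps)
    thus ?thesis unfolding z_def[symmetric] by (simp add: u algebra_simps)
  qed
  show ?thesis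
    unfolding strictly_concave_on_iff
  proof (intro conjI ballI allI impI)
    fix x y u v :: real
    assume *: "x \<in> {0..}" "y \<in> {0..}" "0 < u" "0 < v" "x \<noteq> y" "u + v = 1"
    consider "x < y" | "y < x" using * by linarith
    thus "u * f x + v * f y < f (u *\<^sub>R x + v *\<^sub>R y)"
    proof cases
      case 1 thus ?thesis using key[of x y u v] * by simp
    next
      case 2 thus ?thesis using key[of y x v u] * by (simp add: add.commute)
    qed
  qed (rule convex_real_interval)
qed

text \<open>A nonnegative continuous function with zero integral vanishes everywhere. Strictness of
  an averaged inequality therefore has to be checked at one node \<open>x0\<close> only.\<close>

lemma integral_pos_continuous:
  fixes f :: "real \<Rightarrow> real"
  assumes "continuous_on {0..1} f" "\<And>x. x \<in> {0..1} \<Longrightarrow> 0 \<le> f x" "x0 \<in> {0..1}" "0 < f x0"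
  shows "0 < integral {0..1} f"
proof -
  have int: "f integrable_on {0..1}" using assms(1) integrable_continuous_interval by blast
  have "integral {0..1} f \<noteq> 0"
  proof
    assume "integral {0..1} f = 0"
    hence "(f has_integral 0) (cbox 0 1)" using int by (metis box_real(2) integrable_integral)
    hence "f x0 = 0"
      using has_integral_0_cbox_imp_0[of 0 1 f x0] assms by simp
    thus False using assms(4) by simp
  qed
  moreover have "0 \<le> integral {0..1} f" using int assms(2) by (rule integral_nonneg)
  ultimately show ?thesis by simp
qed

section \<open>Averages over a segment\<close>

text \<open>Parametrising by \<open>[0, 1]\<close> gives one formula for \<open>a < b\<close>,
  \<open>b < a\<close> and the degenerate segment \<open>a = b\<close>, where the value is
  \<open>f a\<close>.\<close>

definition avg :: "(real \<Rightarrow> real) \<Rightarrow> real \<Rightarrow> real \<Rightarrow> real" where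
  "avg f a b = integral {0..1} (\<lambda>y. f (y * a + (1 - y) * b))"

lemma avg_cmult: "avg (\<lambda>x. c * f x) a b = c * avg f a b"
  unfolding avg_def by simp

lemma avg_uminus: "avg (\<lambda>x. - f x) a b = - avg f a b"
  unfolding avg_def by simp

lemma avg_minus_minus: "avg f (- a) (- b) = avg (\<lambda>x. f (- x)) a b"
  unfolding avg_def by (simp add: algebra_simps)

text \<open>This is the fundamental theorem of calculus along the segment. The point
  \<open>0\<close> is exempt from the derivative condition because \<open>lsinhc\<close> and
  \<open>xcoth\<close> are differentiated only away from it.\<close>

lemma avg_eq_divided_difference:
  assumes F: "continuous_on UNIV F" and f: "continuous_on UNIV f"
    and deriv: "\<And>x. x \<noteq> 0 \<Longrightarrow> (F has_real_derivative f x) (at x)"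
  shows "(a - b) * avg f a b = F a - F b"
proof (cases "a = b")
  case False
  let ?l = "\<lambda>y. y * a + (1 - y) * b"
  have "((\<lambda>y. f (?l y) * (a - b)) has_integral F (?l 1) - F (?l 0)) {0..1}"
  proof (rule fundamental_theorem_of_calculus_strong)
    \<comment> \<open>The only parameter at which the line through \<open>a\<close> and
      \<open>b\<close> meets \<open>0\<close>.\<close>
    show "finite {b / (b - a)}" by simp
    show "continuous_on {0..1} (\<lambda>y. F (?l y))"
      by (intro continuous_on_compose2[OF F] continuous_intros) auto
    fix y assume "y \<in> {0..1} - {b / (b - a)}"
    hence "?l y \<noteq> 0" using False by (auto simp: field_simps)
    from deriv[OF this] have "((\<lambda>y. F (?l y)) has_real_derivative f (?l y) * (a - b)) (at y)"
      by (rule DERIV_chain2) (auto intro!: derivative_eq_intros)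
    thus "((\<lambda>y. F (?l y)) has_vector_derivative f (?l y) * (a - b)) (at y)"
      by (simp add: has_real_derivative_iff_has_vector_derivative)
  qed simp
  hence "integral {0..1} (\<lambda>y. f (?l y) * (a - b)) = F (?l 1) - F (?l 0)"
    by (rule integral_unique)
  thus ?thesis unfolding avg_def by (simp add: mult.commute)
qed simp

text \<open>The integrand may depend on the parameter too, so that the lemma can be iterated for an
  average of averages.\<close>

lemma continuous_on_avg_param:
  fixes f :: "'a::topological_space \<Rightarrow> real \<Rightarrow> real"
  assumes "continuous_on UNIV (\<lambda>(x, y). f x y)" "continuous_on UNIV a" "continuous_on UNIV b"
  shows "continuous_on UNIV (\<lambda>x. avg (f x) (a x) (b x))"
proof -
  have "continuous_on UNIV (\<lambda>x. integral (cbox 0 1) (\<lambda>y. f x (y * a x + (1 - y) * b x)))"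
  proof (rule integral_continuous_on_param)
    have "continuous_on (UNIV \<times> cbox 0 1)
        (\<lambda>z. case (fst z, snd z * a (fst z) + (1 - snd z) * b (fst z)) of (x, y) \<Rightarrow> f x y)"
      by (intro continuous_on_compose2[OF assms(1)] continuous_on_Pair continuous_on_add
          continuous_on_mult continuous_on_diff continuous_on_const continuous_on_fst
          continuous_on_snd continuous_on_id continuous_on_compose2[OF assms(2)]
          continuous_on_compose2[OF assms(3)]) auto
    thus "continuous_on (UNIV \<times> cbox 0 1) (\<lambda>(x, y). f x (y * a x + (1 - y) * b x))"
      by (simp add: case_prod_unfold)
  qed
  thus ?thesis by (simp add: avg_def)
qed

text \<open>At each fixed \<open>y\<close> the integrand is \<open>f\<close> at a linear function of
  \<open>(p, q)\<close>, hence concave; a single node supplies strictness.\<close>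

lemma strictly_concave_on_avg:
  assumes f: "continuous_on UNIV f" and conc: "strictly_concave_on {0..} f"
  shows "strictly_concave_on ({0..} \<times> {0..}) (\<lambda>(p, q). avg f p q)"
  unfolding strictly_concave_on_iff
proof (intro conjI ballI allI impI)
  show "convex ({0..} \<times> {0..} :: (real \<times> real) set)"
    by (intro convex_Times convex_real_interval)
  fix z z' :: "real \<times> real" and u v :: real
  assume *: "z \<in> {0..} \<times> {0..}" "z' \<in> {0..} \<times> {0..}" "0 < u" "0 < v" "z \<noteq> z'" "u + v = 1"
  obtain p q p' q' where z: "z = (p, q)" "z' = (p', q')" by fastforce
  have nn: "0 \<le> p" "0 \<le> q" "0 \<le> p'" "0 \<le> q'" using * z by auto
  let ?l = "\<lambda>p q y::real. y * p + (1 - y) * q"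
  let ?D = "\<lambda>y. f (?l (u * p + v * p') (u * q + v * q') y) - (u * f (?l p q y) + v * f (?l p' q' y))"
  have cont: "continuous_on S (\<lambda>y. f (?l p q y))" for p q S
    by (intro continuous_on_compose2[OF f] continuous_intros) auto
  have lin: "?l (u * p + v * p') (u * q + v * q') y = u *\<^sub>R ?l p q y + v *\<^sub>R ?l p' q' y" for y
    by (simp add: algebra_simps)
  have "0 < integral {0..1} ?D"
  proof (rule integral_pos_continuous)
    show "continuous_on {0..1} ?D" by (intro continuous_intros cont)
    show "0 \<le> ?D y" if "y \<in> {0..1}" for y
      unfolding lin using strictly_concave_onD(1)[OF conc _ _ *(3,4,6)] that nn by simp
    \<comment> \<open>The node \<open>1\<close> sees only \<open>p\<close> and the node
      \<open>0\<close> only \<open>q\<close>; distinct pairs differ at one of them.\<close>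
    show "(if p = p' then 0 else 1) \<in> {0..1::real}" by simp
    show "0 < ?D (if p = p' then 0 else 1)"
      unfolding lin using strictly_concave_onD(2)[OF conc _ _ *(3,4,6)] nn * z by auto
  qed
  also have "integral {0..1} ?D = avg f (u * p + v * p') (u * q + v * q')
      - (u * avg f p q + v * avg f p' q')"
    unfolding avg_def
    by (subst integral_diff integral_add integral_mult_right;
        (intro integrable_continuous_interval continuous_intros cont)?)+ simp
  finally show "u * (case z of (p, q) \<Rightarrow> avg f p q) + v * (case z' of (p, q) \<Rightarrow> avg f p q)
      < (case u *\<^sub>R z + v *\<^sub>R z' of (p, q) \<Rightarrow> avg f p q)"
    by (simp add: z)
qed

text \<open>Each \<open>w\<close> in the segment is nonnegative, so dilation by \<open>w\<close>
  preserves concavity; at the node \<open>1\<close> it is \<open>r > 0\<close>, which preserves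
  strictness.\<close>

lemma strictly_concave_on_avg_dilation:
  assumes f: "continuous_on UNIV f" and conc: "strictly_concave_on {0..} f"
    and rs: "0 < r" "0 \<le> s"
  shows "strictly_concave_on {0..} (\<lambda>t. avg (\<lambda>w. f (t * w)) r s)"
  unfolding strictly_concave_on_iff
proof (intro conjI ballI allI impI)
  show "convex ({0..} :: real set)" by (rule convex_real_interval)
  fix t t' u v :: real
  assume *: "t \<in> {0..}" "t' \<in> {0..}" "0 < u" "0 < v" "t \<noteq> t'" "u + v = 1"
  let ?w = "\<lambda>y. y * r + (1 - y) * s"
  let ?D = "\<lambda>y. f ((u * t + v * t') * ?w y) - (u * f (t * ?w y) + v * f (t' * ?w y))"
  have cont: "continuous_on S (\<lambda>y. f (t * ?w y))" for t S
    by (intro continuous_on_compose2[OF f] continuous_intros) auto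
  have lin: "(u * t + v * t') * w = u *\<^sub>R (t * w) + v *\<^sub>R (t' * w)" for w
    by (simp add: algebra_simps)
  have "0 < integral {0..1} ?D"
  proof (rule integral_pos_continuous)
    show "continuous_on {0..1} ?D" by (intro continuous_intros cont)
    show "0 \<le> ?D y" if "y \<in> {0..1}" for y
      unfolding lin using strictly_concave_onD(1)[OF conc _ _ *(3,4,6)] that rs * by simp
    show "1 \<in> {0..1::real}" by simp
    show "0 < ?D 1"
      unfolding lin using strictly_concave_onD(2)[OF conc _ _ *(3,4,6)] rs * by simp
  qed
  also have "integral {0..1} ?D = avg (\<lambda>w. f ((u * t + v * t') * w)) r s
      - (u * avg (\<lambda>w. f (t * w)) r s + v * avg (\<lambda>w. f (t' * w)) r s)"
    unfolding avg_def
    by (subst integral_diff integral_add integral_mult_right;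
        (intro integrable_continuous_interval continuous_intros cont)?)+ simp
  finally show "u * avg (\<lambda>w. f (t * w)) r s + v * avg (\<lambda>w. f (t' * w)) r s
      < avg (\<lambda>w. f ((u *\<^sub>R t + v *\<^sub>R t') * w)) r s"
    by simp
qed

section \<open>The logarithm of sinh x / x and its scaled derivatives\<close>

definition lsinhc :: "real \<Rightarrow> real" where
  "lsinhc x = (if x = 0 then 0 else ln (sinh x / x))"

text \<open>Equals \<open>1 + x * lsinhc'(x)\<close>. The constant \<open>1\<close> cancels in
  differences such as \<open>xcoth (t * r) - xcoth (t * s)\<close>.\<close>

definition xcoth :: "real \<Rightarrow> real" where
  "xcoth x = (if x = 0 then 1 else x * cosh x / sinh x)"

text \<open>The value at \<open>0\<close> is \<open>0 / 0 = 0\<close>, which is the continuous extension.\<close>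

definition dxcoth :: "real \<Rightarrow> real" where
  "dxcoth x = (sinh x * cosh x - x) / (sinh x)\<^sup>2"

lemma sinh_over_pos: "x \<noteq> 0 \<Longrightarrow> 0 < sinh x / (x::real)"
  by (cases "x > 0") (auto simp: zero_less_divide_iff)

lemma has_real_derivative_lsinhc:
  assumes "x \<noteq> 0"
  shows "(lsinhc has_real_derivative (xcoth x - 1) / x) (at x)"
proof -
  have "((\<lambda>x. ln (sinh x / x)) has_real_derivative (xcoth x - 1) / x) (at x)"
    using assms sinh_over_pos[OF assms]
    by (auto intro!: derivative_eq_intros simp: xcoth_def field_simps power2_eq_square)
  moreover have "\<forall>\<^sub>F y in nhds x. lsinhc y = ln (sinh y / y)"
    using t1_space_nhds[OF assms] by (rule eventually_mono) (simp add: lsinhc_def)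
  ultimately show ?thesis by (subst DERIV_cong_ev[OF refl _ refl])
qed

lemma has_real_derivative_xcoth:
  assumes "x \<noteq> 0"
  shows "(xcoth has_real_derivative dxcoth x) (at x)"
proof -
  have "cosh x * cosh x = 1 + sinh x * sinh x"
    using hyperbolic_pythagoras[of x] by (simp add: power2_eq_square)
  hence "((\<lambda>x. x * cosh x / sinh x) has_real_derivative dxcoth x) (at x)"
    using assms
    by (auto intro!: derivative_eq_intros simp: dxcoth_def power2_eq_square divide_simps)
       (simp add: algebra_simps)
  moreover have "\<forall>\<^sub>F y in nhds x. xcoth y = y * cosh y / sinh y"
    using t1_space_nhds[OF assms] by (rule eventually_mono) (simp add: xcoth_def)
  ultimately show ?thesis by (subst DERIV_cong_ev[OF refl _ refl])
qed

lemma has_real_derivative_dxcoth: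
  assumes "x \<noteq> 0"
  shows "(dxcoth has_real_derivative 2 * (x * cosh x - sinh x) / sinh x ^ 3) (at x)"
proof -
  have "((\<lambda>x. (sinh x * cosh x - x) / (sinh x)\<^sup>2) has_real_derivative
      ((cosh x * cosh x + sinh x * sinh x - 1) * (sinh x)\<^sup>2
        - (sinh x * cosh x - x) * (2 * sinh x * cosh x)) / ((sinh x)\<^sup>2 * (sinh x)\<^sup>2)) (at x)"
    using assms by (auto intro!: derivative_eq_intros)
  also have "(cosh x * cosh x + sinh x * sinh x - 1) * (sinh x)\<^sup>2
        - (sinh x * cosh x - x) * (2 * sinh x * cosh x) = 2 * (x * cosh x - sinh x) * sinh x"
    using hyperbolic_pythagoras[of x] by algebra
  also have "2 * (x * cosh x - sinh x) * sinh x / ((sinh x)\<^sup>2 * (sinh x)\<^sup>2)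
      = 2 * (x * cosh x - sinh x) / sinh x ^ 3"
    using assms by (simp add: divide_simps eval_nat_numeral)
  finally show ?thesis unfolding dxcoth_def[abs_def] .
qed

lemma continuous_lsinhc: "continuous_on UNIV lsinhc"
proof -
  have "isCont lsinhc x" for x
  proof (cases "x = 0")
    case True
    have "((\<lambda>x::real. ln (sinh x / x)) \<longlongrightarrow> 0) (at 0)" by real_asymp
    moreover have "\<forall>\<^sub>F x in at 0. ln (sinh x / x) = lsinhc x"
      by (auto simp: eventually_at_filter lsinhc_def)
    ultimately have "(lsinhc \<longlongrightarrow> 0) (at 0)" by (rule Lim_transform_eventually)
    thus ?thesis using True by (simp add: isCont_def lsinhc_def)
  qed (use has_real_derivative_lsinhc DERIV_isCont in blast)
  thus ?thesis by (simp add: continuous_on_eq_continuous_at)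
qed

lemma continuous_xcoth: "continuous_on UNIV xcoth"
proof -
  have "isCont xcoth x" for x
  proof (cases "x = 0")
    case True
    have "((\<lambda>x::real. x * cosh x / sinh x) \<longlongrightarrow> 1) (at 0)" by real_asymp
    moreover have "\<forall>\<^sub>F x in at 0. x * cosh x / sinh x = xcoth x"
      by (auto simp: eventually_at_filter xcoth_def)
    ultimately have "(xcoth \<longlongrightarrow> 1) (at 0)" by (rule Lim_transform_eventually)
    thus ?thesis using True by (simp add: isCont_def xcoth_def)
  qed (use has_real_derivative_xcoth DERIV_isCont in blast)
  thus ?thesis by (simp add: continuous_on_eq_continuous_at)
qed

lemma continuous_dxcoth: "continuous_on UNIV dxcoth"
proof -
  have "isCont dxcoth x" for x
  proof (cases "x = 0")
    case True
    have "(dxcoth \<longlongrightarrow> 0) (at 0)" unfolding dxcoth_def[abs_def] by real_asymp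
    thus ?thesis using True by (simp add: isCont_def dxcoth_def)
  qed (use has_real_derivative_dxcoth DERIV_isCont in blast)
  thus ?thesis by (simp add: continuous_on_eq_continuous_at)
qed

lemma xcoth_minus: "xcoth (- x) = xcoth x"
  by (simp add: xcoth_def)

lemma dxcoth_minus: "dxcoth (- x) = - dxcoth x"
  by (simp add: dxcoth_def divide_simps)

section \<open>Strict concavity of \<open>dxcoth\<close> on the half-line\<close>

lemma sinh_less_mult_cosh:
  assumes "0 < (x::real)"
  shows "sinh x < x * cosh x"
proof -
  have "0 * cosh 0 - sinh 0 < x * cosh x - sinh (x::real)"
  proof (rule DERIV_pos_imp_increasing_open[OF assms])
    fix y :: real assume "0 < y"
    thus "\<exists>l. ((\<lambda>x. x * cosh x - sinh x) has_real_derivative l) (at y) \<and> 0 < l"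
      by (intro exI[of _ "y * sinh y"]) (auto intro!: derivative_eq_intros)
  qed (intro continuous_intros)
  thus ?thesis by simp
qed

text \<open>The difference of the two sides vanishes at \<open>0\<close> and has a positive
  derivative by \<open>sinh_less_mult_cosh\<close>. It gives the sign of the second derivative of
  \<open>dxcoth\<close>.\<close>

lemma three_sinh_cosh_less:
  assumes "0 < (x::real)"
  shows "3 * sinh x * cosh x < 2 * x * (cosh x)\<^sup>2 + x"
proof -
  let ?f = "\<lambda>x::real. 2 * x * (cosh x)\<^sup>2 + x - 3 * sinh x * cosh x"
  have "?f 0 < ?f x"
  proof (rule DERIV_pos_imp_increasing_open[OF assms])
    fix y :: real assume y: "0 < y"
    have "(?f has_real_derivative 4 * sinh y * (y * cosh y - sinh y)) (at y)"
      using hyperbolic_pythagoras[of y]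
      by (auto intro!: derivative_eq_intros simp: algebra_simps power2_eq_square)
    thus "\<exists>l. (?f has_real_derivative l) (at y) \<and> 0 < l"
      using sinh_less_mult_cosh[OF y] y
      by (intro exI[of _ "4 * sinh y * (y * cosh y - sinh y)"]) simp
  qed (intro continuous_intros)
  thus ?thesis by simp
qed

lemma strictly_concave_on_dxcoth: "strictly_concave_on {0..} dxcoth"
proof (rule strictly_concave_on_atLeast_deriv[OF continuous_dxcoth has_real_derivative_dxcoth])
  let ?g = "\<lambda>x::real. 2 * (x * cosh x - sinh x) / sinh x ^ 3"
  fix x y :: real assume xy: "0 < x" "x < y"
  show "?g y < ?g x"
  proof (rule DERIV_neg_imp_decreasing[OF xy(2)])
    fix w assume "x \<le> w"
    hence w: "0 < w" using xy by simp
    have "(?g has_real_derivative (2 * (w * sinh w) * sinh w ^ 3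
        - 2 * (w * cosh w - sinh w) * (3 * (sinh w)\<^sup>2 * cosh w)) / (sinh w ^ 3 * sinh w ^ 3)) (at w)"
      using w by (auto intro!: derivative_eq_intros)
    also have "2 * (w * sinh w) * sinh w ^ 3 - 2 * (w * cosh w - sinh w) * (3 * (sinh w)\<^sup>2 * cosh w)
        = 2 * (3 * sinh w * cosh w - 2 * w * (cosh w)\<^sup>2 - w) * (sinh w)\<^sup>2"
      using hyperbolic_pythagoras[of w] by algebra
    also have "2 * (3 * sinh w * cosh w - 2 * w * (cosh w)\<^sup>2 - w) * (sinh w)\<^sup>2 / (sinh w ^ 3 * sinh w ^ 3)
        = 2 * (3 * sinh w * cosh w - 2 * w * (cosh w)\<^sup>2 - w) / sinh w ^ 4"
      using w by (simp add: divide_simps)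
    finally have "(?g has_real_derivative
        2 * (3 * sinh w * cosh w - 2 * w * (cosh w)\<^sup>2 - w) / sinh w ^ 4) (at w)" .
    moreover have "2 * (3 * sinh w * cosh w - 2 * w * (cosh w)\<^sup>2 - w) / sinh w ^ 4 < 0"
      using three_sinh_cosh_less[OF w] w by (intro divide_neg_pos) auto
    ultimately show "\<exists>l. (?g has_real_derivative l) (at w) \<and> l < 0" by blast
  qed
qed simp

section \<open>The logarithm of the mean as a double average\<close>

definition inner_avg :: "real \<Rightarrow> real \<Rightarrow> real \<Rightarrow> real" where
  "inner_avg t r s = avg (\<lambda>w. dxcoth (t * w)) r s"

definition double_avg :: "real \<Rightarrow> real \<Rightarrow> real \<Rightarrow> real \<Rightarrow> real" where
  "double_avg p q r s = avg (\<lambda>t. inner_avg t r s) p q"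

lemma continuous_inner_avg: "continuous_on UNIV (\<lambda>(t, r, s). inner_avg t r s)"
  unfolding inner_avg_def case_prod_unfold
  by (intro continuous_on_avg_param)
     (auto simp: case_prod_unfold intro!: continuous_on_compose2[OF continuous_dxcoth] continuous_intros)

lemma continuous_inner_avg_fst: "continuous_on UNIV (\<lambda>t. inner_avg t r s)"
  using continuous_on_compose2[OF continuous_inner_avg, of UNIV "\<lambda>t. (t, r, s)"]
  by (simp add: continuous_intros)

text \<open>Joint continuity, valid also across degenerate parameters, is what evaluates the limits
  in \<open>ext_mean\<close>.\<close>

lemma continuous_double_avg: "continuous_on UNIV (\<lambda>(p, q, r, s). double_avg p q r s)"
proof -
  have "continuous_on UNIV
      (\<lambda>x :: (real \<times> real \<times> real \<times> real) \<times> real. 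
        case (snd x, fst (snd (snd (fst x))), snd (snd (snd (fst x)))) of (t, r, s) \<Rightarrow> inner_avg t r s)"
    by (rule continuous_on_compose2[OF continuous_inner_avg]) (auto intro!: continuous_intros)
  thus ?thesis
    unfolding double_avg_def case_prod_unfold
    by (intro continuous_on_avg_param) (auto simp: case_prod_unfold intro!: continuous_intros)
qed

lemma inner_avg_minus: "inner_avg (- t) r s = - inner_avg t r s"
  by (simp add: inner_avg_def dxcoth_minus avg_uminus)

lemma inner_avg_minus_minus: "inner_avg t (- r) (- s) = - inner_avg t r s"
  by (simp add: inner_avg_def avg_minus_minus dxcoth_minus avg_uminus)

lemma double_avg_minus1: "double_avg (- p) (- q) r s = - double_avg p q r s"
  by (simp add: double_avg_def avg_minus_minus inner_avg_minus avg_uminus)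

text \<open>Serves twice: to exchange the cases \<open>r + s > 0\<close> and
  \<open>r + s < 0\<close>, and to replace \<open>(ln a - ln b) / 2\<close> by its absolute
  value.\<close>

lemma double_avg_minus2: "double_avg p q (- r) (- s) = - double_avg p q r s"
  by (simp add: double_avg_def inner_avg_minus_minus avg_uminus)

text \<open>As a function of \<open>w\<close>, \<open>xcoth (t * w)\<close> is a primitive of
  \<open>t * dxcoth (t * w)\<close>.\<close>

lemma inner_avg_eq: "t * ((r - s) * inner_avg t r s) = xcoth (t * r) - xcoth (t * s)"
proof (cases "t = 0")
  case False
  have "(r - s) * avg (\<lambda>w. t * dxcoth (t * w)) r s = xcoth (t * r) - xcoth (t * s)"
  proof (rule avg_eq_divided_difference)
    show "continuous_on UNIV (\<lambda>w. xcoth (t * w))" "continuous_on UNIV (\<lambda>w. t * dxcoth (t * w))"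
      by (intro continuous_intros continuous_on_compose2[OF continuous_xcoth]
          continuous_on_compose2[OF continuous_dxcoth]; simp)+
    fix w :: real assume "w \<noteq> 0"
    hence "t * w \<noteq> 0" using False by simp
    from DERIV_chain2[OF has_real_derivative_xcoth[OF this] DERIV_cmult_Id]
    show "((\<lambda>w. xcoth (t * w)) has_real_derivative t * dxcoth (t * w)) (at w)"
      by (simp add: mult.commute)
  qed
  thus ?thesis by (simp add: inner_avg_def avg_cmult mult.left_commute)
qed simp

text \<open>Allows \<open>s \<le> r\<close> to be assumed when concavity is proved.\<close>

lemma inner_avg_commute: "inner_avg t r s = inner_avg t s r"
proof (cases "t = 0 \<or> r = s")
  case True
  thus ?thesis by (auto simp: inner_avg_def avg_def dxcoth_def)
next
  case False
  thus ?thesis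
    using inner_avg_eq[of t r s] inner_avg_eq[of t s r]
    by (smt (verit) minus_mult_minus mult_cancel_left mult_minus_right)
qed

text \<open>By \<open>inner_avg_eq\<close>, \<open>(r - s) * inner_avg t r s\<close> is the
  derivative in \<open>t\<close> of \<open>lsinhc (t * r) - lsinhc (t * s)\<close>.\<close>

lemma double_avg_eq:
  assumes "r \<noteq> 0" "s \<noteq> 0"
  shows "(p - q) * ((r - s) * double_avg p q r s) =
    (lsinhc (p * r) - lsinhc (p * s)) - (lsinhc (q * r) - lsinhc (q * s))"
proof -
  have "(p - q) * avg (\<lambda>t. (r - s) * inner_avg t r s) p q =
    (lsinhc (p * r) - lsinhc (p * s)) - (lsinhc (q * r) - lsinhc (q * s))"
  proof (rule avg_eq_divided_difference)
    show "continuous_on UNIV (\<lambda>t. lsinhc (t * r) - lsinhc (t * s))"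
      by (intro continuous_intros continuous_on_compose2[OF continuous_lsinhc]; simp)
    show "continuous_on UNIV (\<lambda>t. (r - s) * inner_avg t r s)"
      by (intro continuous_intros continuous_inner_avg_fst)
    fix t :: real assume t: "t \<noteq> 0"
    have "((\<lambda>t. lsinhc (t * r)) has_real_derivative (xcoth (t * r) - 1) / t) (at t)" if "r \<noteq> 0" for r
    proof -
      have "t * r \<noteq> 0" using that t by simp
      from DERIV_chain2[OF has_real_derivative_lsinhc[OF this] DERIV_cmult_right[OF DERIV_ident]]
      show ?thesis using that by simp
    qed
    from DERIV_diff[OF this[OF assms(1)] this[OF assms(2)]]
    have "((\<lambda>t. lsinhc (t * r) - lsinhc (t * s)) has_real_derivative
        (xcoth (t * r) - xcoth (t * s)) / t) (at t)"
      by (simp add: diff_divide_distrib)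
    thus "((\<lambda>t. lsinhc (t * r) - lsinhc (t * s)) has_real_derivative
        (r - s) * inner_avg t r s) (at t)"
      using t by (simp flip: inner_avg_eq)
  qed
  thus ?thesis by (simp add: double_avg_def avg_cmult)
qed

lemma strictly_concave_on_inner_avg:
  assumes "0 < r + s"
  shows "strictly_concave_on {0..} (\<lambda>t. inner_avg t r s)"
proof -
  note conc = strictly_concave_on_avg_dilation
      [OF continuous_dxcoth strictly_concave_on_dxcoth, folded inner_avg_def]
  have *: "strictly_concave_on {0..} (\<lambda>t. inner_avg t r s)" if rs: "0 < r + s" "s \<le> r" for r s
  proof (cases "0 \<le> s")
    case True
    thus ?thesis using conc[of r s] rs by linarith
  next
    case False
    \<comment> \<open>\<open>dxcoth\<close> is odd, so the part of the average over \<open>[s, -s]\<close> cancels.\<close>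
    have "(r - s) * inner_avg t r s = (r - (- s)) * inner_avg t r (- s)" for t
    proof (cases "t = 0")
      case True
      thus ?thesis by (simp add: inner_avg_def avg_def dxcoth_def)
    next
      case False
      have "t * ((r - s) * inner_avg t r s) = t * ((r - (- s)) * inner_avg t r (- s))"
        unfolding inner_avg_eq by (simp add: xcoth_minus)
      thus ?thesis using False by simp
    qed
    \<comment> \<open>The factor is the length of the surviving segment \<open>[-s, r]\<close> over
      that of \<open>[s, r]\<close>. It is positive, so strict concavity carries over.\<close>
    hence "inner_avg t r s = 0 + (r + s) / (r - s) * inner_avg t r (- s)" for t
      using False rs by (simp add: field_simps)
    thus ?thesis
      using strictly_concave_on_affine[OF conc[of r "- s"], of "(r + s) / (r - s)" 0] False rs
      by simp
  qed
  show ?thesis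
    using *[of r s] *[of s r] assms by (cases "s \<le> r") (simp_all add: add.commute inner_avg_commute[of _ r s])
qed

lemma strictly_concave_on_double_avg:
  assumes "0 < r + s"
  shows "strictly_concave_on ({0..} \<times> {0..}) (\<lambda>(p, q). double_avg p q r s)"
  unfolding double_avg_def
  by (rule strictly_concave_on_avg[OF continuous_inner_avg_fst strictly_concave_on_inner_avg[OF assms]])

section \<open>The extended mean\<close>

lemma powr_diff_eq_sinh:
  fixes a b x :: real
  assumes "0 < a" "0 < b"
  shows "a powr x - b powr x =
    2 * exp (x * ((ln a + ln b) / 2)) * sinh ((ln a - ln b) / 2 * x)"
proof -
  have "2 * exp (x * ((ln a + ln b) / 2)) * sinh ((ln a - ln b) / 2 * x) =
      exp (x * ((ln a + ln b) / 2) + (ln a - ln b) / 2 * x) -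
      exp (x * ((ln a + ln b) / 2) + - ((ln a - ln b) / 2 * x))"
    unfolding exp_add sinh_field_def by (simp add: field_simps)
  also have "x * ((ln a + ln b) / 2) + (ln a - ln b) / 2 * x = x * ln a"
    by (simp add: field_simps)
  also have "x * ((ln a + ln b) / 2) + - ((ln a - ln b) / 2 * x) = x * ln b"
    by (simp add: field_simps)
  finally show ?thesis using assms by (simp add: powr_def)
qed

text \<open>The quotient \<open>sinh (c * x) / (c * x)\<close> is positive for either sign of
  \<open>c * x\<close>, so it can be written as an exponential. The factors \<open>2 * c * x\<close>
  cancel in the formula of the mean.\<close>

lemma powr_diff_quotient:
  fixes a b x :: real
  assumes "0 < a" "0 < b" "a \<noteq> b" "x \<noteq> 0"
  defines "c \<equiv> (ln a - ln b) / 2"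
  shows "a powr x - b powr x = 2 * c * x * exp (x * ((ln a + ln b) / 2) + lsinhc (c * x))"
proof -
  have "ln a \<noteq> ln b" using assms(1-3) by simp
  hence "c * x \<noteq> 0" using assms(4) by (simp add: c_def)
  hence "sinh (c * x) = c * x * exp (lsinhc (c * x))"
    using sinh_over_pos by (simp add: lsinhc_def)
  thus ?thesis
    using powr_diff_eq_sinh[OF assms(1,2), of x, folded c_def] by (simp add: exp_add)
qed

lemma ext_mean_formula_eq:
  assumes ab: "0 < a" "0 < b" "a \<noteq> b" and nd: "(p, q, r, s) \<in> ext_nondeg"
  defines "c \<equiv> (ln a - ln b) / 2"
  shows "ext_mean_formula p q r s a b = exp ((ln a + ln b) / 2 + c * double_avg p q (c * r) (c * s))"
proof -
  define m where "m = (ln a + ln b) / 2"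
  define E where "E x = m * x + lsinhc (c * x)" for x
  have ne: "p \<noteq> 0" "q \<noteq> 0" "r \<noteq> 0" "s \<noteq> 0" "p \<noteq> q" "r \<noteq> s"
    using nd by (auto simp: ext_nondeg_def)
  have c: "c \<noteq> 0" using ab by (simp add: c_def)
  have D: "a powr x - b powr x = 2 * c * x * exp (E x)" if "x \<noteq> 0" for x
    using powr_diff_quotient[OF ab that] by (simp add: c_def m_def E_def mult.commute)
  have "(a powr (p * r) - b powr (p * r)) / (a powr (p * s) - b powr (p * s)) *
     ((a powr (q * s) - b powr (q * s)) / (a powr (q * r) - b powr (q * r)))
    = exp (E (p * r)) / exp (E (p * s)) * (exp (E (q * s)) / exp (E (q * r)))"
    using ne c by (simp add: D)
  also have "\<dots> = exp (E (p * r) - E (p * s) + (E (q * s) - E (q * r)))"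
    by (simp add: exp_add exp_diff)
  \<comment> \<open>The linear part of \<open>E\<close> yields \<open>m\<close> times the inverse of
    the outer exponent, hence the factor \<open>exp m\<close>, the geometric mean of
    \<open>a\<close> and \<open>b\<close>.\<close>
  also have "E (p * r) - E (p * s) + (E (q * s) - E (q * r)) =
      m * ((p - q) * (r - s)) + ((lsinhc (p * (c * r)) - lsinhc (p * (c * s)))
        - (lsinhc (q * (c * r)) - lsinhc (q * (c * s))))"
    unfolding E_def by (simp add: algebra_simps)
  also have "\<dots> = (m + c * double_avg p q (c * r) (c * s)) * ((p - q) * (r - s))"
    using double_avg_eq[of "c * r" "c * s" p q] ne c by (simp add: algebra_simps)
  finally show ?thesis
    unfolding ext_mean_formula_def m_def[symmetric] using ne
    by (simp add: powr_def)
qed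

text \<open>\<open>Lim\<close> is pinned down by convergence only along a nontrivial filter, so
  every point must be approachable through nondegenerate parameters.\<close>

lemma at_within_ext_nondeg_neq_bot: "at z within ext_nondeg \<noteq> bot"
proof -
  obtain p q r s where z: "z = (p, q, r, s)" by (metis prod_cases4)
  \<comment> \<open>The speeds \<open>1\<close> and \<open>2\<close> differ, so \<open>p - q\<close>
    and \<open>r - s\<close> move as well. Each of the six factors is then nonconstant and affine in
    \<open>e\<close>, with a single zero.\<close>
  let ?f = "\<lambda>e::real. (p + e, q + 2 * e, r + e, s + 2 * e)"
  have ev: "\<forall>\<^sub>F e in at 0. x + k * e \<noteq> 0" if "k \<noteq> 0" for x k :: real
    using eventually_neq_at_within[of "- x / k" 0 UNIV]
    by (rule eventually_mono) (use that in \<open>auto simp: field_simps\<close>)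
  have "filterlim ?f (at z within ext_nondeg) (at 0)"
    unfolding filterlim_at
  proof
    have "\<forall>\<^sub>F e in at 0. p + 1 * e \<noteq> 0 \<and> q + 2 * e \<noteq> 0 \<and> r + 1 * e \<noteq> 0 \<and> s + 2 * e \<noteq> 0 \<and>
        (p - q) + (-1) * e \<noteq> 0 \<and> (r - s) + (-1) * e \<noteq> 0 \<and> e \<noteq> 0"
      by (intro eventually_conj ev eventually_neq_at_within) auto
    thus "\<forall>\<^sub>F e in at 0. ?f e \<in> ext_nondeg \<and> ?f e \<noteq> z"
    proof (rule eventually_mono)
      fix e :: real
      have "p + e - (q + 2 * e) = (p - q) + (-1) * e" "r + e - (s + 2 * e) = (r - s) + (-1) * e"
        by simp_all
      moreover assume *: "p + 1 * e \<noteq> 0 \<and> q + 2 * e \<noteq> 0 \<and> r + 1 * e \<noteq> 0 \<and> s + 2 * e \<noteq> 0 \<and>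
        (p - q) + (-1) * e \<noteq> 0 \<and> (r - s) + (-1) * e \<noteq> 0 \<and> e \<noteq> 0"
      ultimately have "?f e \<in> ext_nondeg"
        by (simp only: ext_nondeg_def mem_Collect_eq case_prod_conv mult_eq_0_iff mult_1) simp
      thus "?f e \<in> ext_nondeg \<and> ?f e \<noteq> z"
        using * by (simp add: z)
    qed
    show "(?f \<longlongrightarrow> z) (at 0)"
      unfolding z by (auto intro!: tendsto_eq_intros)
  qed
  thus ?thesis
    by (metis (no_types) at_neq_bot filterlim_def filtermap_bot_iff le_bot)
qed

text \<open>The formula agrees on \<open>ext_nondeg\<close> with a function \<open>L\<close>
  continuous everywhere, so its limits are the values of \<open>L\<close>. The absolute value makes
  \<open>c\<close> positive, as the transfer of concavity requires.\<close>

lemma ext_mean_eq: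
  assumes ab: "0 < a" "0 < b" "a \<noteq> b"
  defines "c \<equiv> \<bar>ln a - ln b\<bar> / 2"
  shows "ext_mean p q r s a b = exp ((ln a + ln b) / 2 + c * double_avg p q (c * r) (c * s))"
proof -
  define d where "d = (ln a - ln b) / 2"
  define L where "L = (\<lambda>(p, q, r, s). exp ((ln a + ln b) / 2 + d * double_avg p q (d * r) (d * s)))"
  have formula: "ext_mean_formula p q r s a b = L (p, q, r, s)" if "(p, q, r, s) \<in> ext_nondeg" for p q r s
    using ext_mean_formula_eq[OF ab that] by (simp add: L_def d_def)
  have "continuous_on UNIV (\<lambda>x. case (fst x, fst (snd x), d * fst (snd (snd x)), d * snd (snd (snd x)))
      of (p, q, r, s) \<Rightarrow> double_avg p q r s)"
    by (rule continuous_on_compose2[OF continuous_double_avg]) (auto intro!: continuous_intros)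
  hence "continuous_on UNIV L"
    unfolding L_def case_prod_unfold by (auto intro!: continuous_intros)
  hence "(L \<longlongrightarrow> L z) (at z within ext_nondeg)" for z
    by (meson UNIV_I continuous_on_def tendsto_within_subset subset_UNIV)
  hence "((\<lambda>(p, q, r, s). ext_mean_formula p q r s a b) \<longlongrightarrow> L z) (at z within ext_nondeg)" for z
    by (rule Lim_transform_eventually)
       (auto simp: eventually_at_filter formula intro!: always_eventually)
  hence "Lim (at z within ext_nondeg) (\<lambda>(p, q, r, s). ext_mean_formula p q r s a b) = L z" for z
    by (rule tendsto_Lim[OF at_within_ext_nondeg_neq_bot])
  hence "ext_mean p q r s a b = L (p, q, r, s)"
    using ab formula by (simp add: ext_mean_def)
  moreover have "d = c \<or> d = - c" by (auto simp: c_def d_def)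
  ultimately show ?thesis by (auto simp: L_def double_avg_minus2)
qed

theorem theorem3p1:
  fixes r s a b :: real
  assumes "a > 0" and "b > 0" and "a \<noteq> b"
  shows
    "(r + s > 0 \<longrightarrow>
        strictly_bivariate_log_concave_on ({0..} \<times> {0..}) (\<lambda>(p, q). ext_mean p q r s a b) \<and>
        strictly_bivariate_log_convex_on ({..0} \<times> {..0}) (\<lambda>(p, q). ext_mean p q r s a b)) \<and>
     (r + s < 0 \<longrightarrow>
        strictly_bivariate_log_convex_on ({0..} \<times> {0..}) (\<lambda>(p, q). ext_mean p q r s a b) \<and>
        strictly_bivariate_log_concave_on ({..0} \<times> {..0}) (\<lambda>(p, q). ext_mean p q r s a b))"
proof -
  define c where "c = \<bar>ln a - ln b\<bar> / 2"
  define m where "m = (ln a + ln b) / 2"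
  define f where "f r s = (\<lambda>(p, q). m + c * double_avg p q (c * r) (c * s))" for r s
  have c: "c > 0" using assms by (simp add: c_def)
  have mean: "(\<lambda>(p, q). ext_mean p q r s a b) = (\<lambda>z. exp (f r s z))"
    using ext_mean_eq[OF assms] by (auto simp: f_def c_def m_def)
  have conc: "strictly_concave_on ({0..} \<times> {0..}) (f r s)" if "r + s > 0" for r s
  proof -
    have "0 < c * r + c * s" using that c by (simp flip: distrib_left)
    from strictly_concave_on_affine[OF strictly_concave_on_double_avg[OF this] c, of m]
    show ?thesis by (simp add: f_def case_prod_unfold)
  qed
  have quad: "convex ({..0} \<times> {..0} :: (real \<times> real) set)"
    by (intro convex_Times convex_real_interval)
  have conc': "strictly_concave_on ({..0} \<times> {..0}) (\<lambda>z. f r s (- z))" if "r + s > 0" for r s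
    by (rule strictly_concave_on_reflect[OF conc[OF that] quad]) auto
  \<comment> \<open>The logarithm of the mean is odd about its constant term \<open>m\<close>, both
    in \<open>(p, q)\<close> and in \<open>(r, s)\<close>; reflecting both pairs leaves it
    unchanged.\<close>
  have refl: "f r s = (\<lambda>z. 2 * m - f r s (- z))" "f (- r) (- s) = (\<lambda>z. 2 * m - f r s z)"
      "f (- r) (- s) = (\<lambda>z. f r s (- z))" for r s
    by (auto simp: f_def double_avg_minus1 double_avg_minus2)
  have conv: "strictly_convex_on ({..0} \<times> {..0}) (f r s)" if "r + s > 0" for r s
    by (subst refl(1)) (rule strictly_convex_on_const_minus[OF conc'[OF that]])
  have neg: "strictly_convex_on ({0..} \<times> {0..}) (f r s)"
      "strictly_concave_on ({..0} \<times> {..0}) (f r s)" if "r + s < 0"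
    using strictly_convex_on_const_minus[OF conc[of "- r" "- s"], of "2 * m", folded refl(2)]
      conc'[of "- r" "- s", folded refl(3)] that by simp_all
  show ?thesis
    unfolding mean strictly_bivariate_log_convex_on_def strictly_bivariate_log_concave_on_def
    using conc conv neg by simp
qed

end
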